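(* Let $\Omega$ be an admissible curve in the pseudo-Galilean 4-space $G_1^4$ parametrized by arclength $s$, with Frenet-Serret frame $\{T,N,B_1,B_2\}$ and curvatures $\kappa,\tau,\sigma\neq0$. Then the energies (with respect to the Sasaki metric) of the orthonormal frame fields along the $s$-lines are $$E_{T_s}=\frac{s}{2}+\frac{\varepsilon_1}{2}\int\kappa^2\,ds+c_1,$$ $$E_{N_s}=\frac{\varepsilon_1}{2}s+\frac{\varepsilon_2}{2}\int\tau^2\,ds+c_2,$$ $$E_{B_{1}s}=\frac{\varepsilon_2}{2}s+\frac{\varepsilon_1}{2}\int\tau^2\,ds+\frac{\varepsilon_3}{2}\int\sigma^2\,ds+c_3,$$ $$E_{B_{2}s}=\frac{\varepsilon_3}{2}s+\frac{\varepsilon_3}{2}\int\sigma^2\,ds+c_4,$$ where $c_1,c_2,c_3,c_4\in\mathbb{R}$.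
   Context: The pseudo-Galilean 4-space $G_1^4$ is $\mathbb{R}^4$ with the scalar product of vectors $U=(u_1,u_2,u_3,u_4)$, $V=(v_1,v_2,v_3,v_4)$ given by $\langle U,V\rangle=u_1v_1$ if $u_1\ne0$ or $v_1\neq0$, and $\langle U,V\rangle=-u_2v_2+u_3v_3+u_4v_4$ if $u_1=v_1=0$. A vector is isotropic if its first component is $0$. A curve $\alpha=(x,y,z,w)$ is admissible if $x'\neq0$ everywhere; arclength parametrization means the tangent $T=\frac{\partial\Omega}{\partial s}$ satisfies $\langle T,T\rangle=1$. The vectors $N,B_1,B_2$ are isotropic, $\{T,N,B_1,B_2\}$ are mutually orthogonal, and $\langle T,T\rangle=1$, $\langle N,N\rangle=\varepsilon_1$, $\langle B_1,B_1\rangle=\varepsilon_2$, $\langle B_2,B_2\rangle=\varepsilon_3$, where $\varepsilon_i\in\{\pm1\}$ and $\varepsilon_3=-1$ if $\varepsilon_1=\varepsilon_2=1$, $\varepsilon_3=1$ otherwise. The frame satisfies the Frenet-Serret equations $$\frac{\partial T}{\partial s}=\varepsilon_1\kappa N,\quad \frac{\partial N}{\partial s}=\varepsilon_2\tau B_1,\quad \frac{\partial B_1}{\partial s}=-\varepsilon_1\tau N+\varepsilon_3\sigma B_2,\quad \frac{\partial B_2}{\partial s}=-\varepsilon_2\sigma B_1,$$ where $\kappa,\tau,\sigma$ are the first, second and third curvatures. The energy along the $s$-lines of a frame field $X\in\{T,N,B_1,B_2\}$ is $E_{X_s}=\frac12\int\rho_s(dX(X),dX(X))\,ds$ (an indefinite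 integral), where $\rho_s$ is the Sasaki metric, whose value is the sum of a base part and a covariant-derivative part: $$\rho_s(dX(X),dX(X))=\langle X,X\rangle+\left\langle\frac{\partial X}{\partial s},\frac{\partial X}{\partial s}\right\rangle.$$
   Formalization: In the energy of B_2 the coefficient of the integral of sigma^2 is epsilon_2/2 instead of the printed epsilon_3/2, which is false when epsilon_2 and epsilon_3 differ, because B_2' = -epsilon_2 sigma B_1 and <B_1,B_1> = epsilon_2. *)

theory Defs
  imports "HOL-Analysis.Analysis"
begin

text \<open>The scalar product of the pseudo-Galilean 4-space. It is bilinear only on isotropic vectors.\<close>

definition pg_inner :: "real ^ 4 \<Rightarrow> real ^ 4 \<Rightarrow> real" where
  "pg_inner U V =
     (if U $ 1 \<noteq> 0 \<or> V $ 1 \<noteq> 0 then U $ 1 * V $ 1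
      else - (U $ 2 * V $ 2) + U $ 3 * V $ 3 + U $ 4 * V $ 4)"

definition isotropic :: "real ^ 4 \<Rightarrow> bool" where
  "isotropic U \<longleftrightarrow> U $ 1 = 0"

text \<open>Parameter domains are open intervals, bounded or not, so that all derivatives are two-sided.\<close>

definition admissible_curve :: "real set \<Rightarrow> (real \<Rightarrow> real ^ 4) \<Rightarrow> bool" where
  "admissible_curve I \<Omega> \<longleftrightarrow>
     (\<forall>s\<in>I. \<Omega> differentiable (at s) \<and> vector_derivative \<Omega> (at s) $ 1 \<noteq> 0)"

definition arclength_parametrized :: "real set \<Rightarrow> (real \<Rightarrow> real ^ 4) \<Rightarrow> bool" where
  "arclength_parametrized I \<Omega> \<longleftrightarrow>
     (\<forall>s\<in>I. pg_inner (vector_derivative \<Omega> (at s)) (vector_derivative \<Omega> (at s)) = 1)"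

definition pg_orthonormal_frame ::
  "real \<Rightarrow> real \<Rightarrow> real \<Rightarrow> real ^ 4 \<Rightarrow> real ^ 4 \<Rightarrow> real ^ 4 \<Rightarrow> real ^ 4 \<Rightarrow> bool" where
  "pg_orthonormal_frame \<epsilon>\<^sub>1 \<epsilon>\<^sub>2 \<epsilon>\<^sub>3 T N B\<^sub>1 B\<^sub>2 \<longleftrightarrow>
     isotropic N \<and> isotropic B\<^sub>1 \<and> isotropic B\<^sub>2 \<and>
     pg_inner T N = 0 \<and> pg_inner T B\<^sub>1 = 0 \<and> pg_inner T B\<^sub>2 = 0 \<and>
     pg_inner N B\<^sub>1 = 0 \<and> pg_inner N B\<^sub>2 = 0 \<and> pg_inner B\<^sub>1 B\<^sub>2 = 0 \<and>
     pg_inner T T = 1 \<and> pg_inner N N = \<epsilon>\<^sub>1 \<and> pg_inner B\<^sub>1 B\<^sub>1 = \<epsilon>\<^sub>2 \<and> pg_inner B\<^sub>2 B\<^sub>2 = \<epsilon>\<^sub>3"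

definition frenet_signs :: "real \<Rightarrow> real \<Rightarrow> real \<Rightarrow> bool" where
  "frenet_signs \<epsilon>\<^sub>1 \<epsilon>\<^sub>2 \<epsilon>\<^sub>3 \<longleftrightarrow>
     \<epsilon>\<^sub>1 \<in> {1, -1} \<and> \<epsilon>\<^sub>2 \<in> {1, -1} \<and> \<epsilon>\<^sub>3 = (if \<epsilon>\<^sub>1 = 1 \<and> \<epsilon>\<^sub>2 = 1 then -1 else 1)"

definition frenet_serret_frame ::
  "real set \<Rightarrow> (real \<Rightarrow> real ^ 4) \<Rightarrow> real \<Rightarrow> real \<Rightarrow> real \<Rightarrow>
   (real \<Rightarrow> real ^ 4) \<Rightarrow> (real \<Rightarrow> real ^ 4) \<Rightarrow> (real \<Rightarrow> real ^ 4) \<Rightarrow> (real \<Rightarrow> real ^ 4) \<Rightarrow>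
   (real \<Rightarrow> real) \<Rightarrow> (real \<Rightarrow> real) \<Rightarrow> (real \<Rightarrow> real) \<Rightarrow> bool" where
  "frenet_serret_frame I \<Omega> \<epsilon>\<^sub>1 \<epsilon>\<^sub>2 \<epsilon>\<^sub>3 T N B\<^sub>1 B\<^sub>2 \<kappa> \<tau> \<sigma> \<longleftrightarrow>
     frenet_signs \<epsilon>\<^sub>1 \<epsilon>\<^sub>2 \<epsilon>\<^sub>3 \<and>
     (\<forall>s\<in>I.
        T s = vector_derivative \<Omega> (at s) \<and>
        pg_orthonormal_frame \<epsilon>\<^sub>1 \<epsilon>\<^sub>2 \<epsilon>\<^sub>3 (T s) (N s) (B\<^sub>1 s) (B\<^sub>2 s) \<and>
        (T has_vector_derivative (\<epsilon>\<^sub>1 * \<kappa> s) *\<^sub>R N s) (at s) \<and>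
        (N has_vector_derivative (\<epsilon>\<^sub>2 * \<tau> s) *\<^sub>R B\<^sub>1 s) (at s) \<and>
        (B\<^sub>1 has_vector_derivative
           (- \<epsilon>\<^sub>1 * \<tau> s) *\<^sub>R N s + (\<epsilon>\<^sub>3 * \<sigma> s) *\<^sub>R B\<^sub>2 s) (at s) \<and>
        (B\<^sub>2 has_vector_derivative (- \<epsilon>\<^sub>2 * \<sigma> s) *\<^sub>R B\<^sub>1 s) (at s))"

text \<open>The value of the Sasaki metric on \<open>dX(X)\<close> at the parameter \<open>s\<close>: base part plus
  covariant-derivative part.\<close>

definition sasaki_value :: "(real \<Rightarrow> real ^ 4) \<Rightarrow> real \<Rightarrow> real" where
  "sasaki_value X s =
     pg_inner (X s) (X s)
     + pg_inner (vector_derivative X (at s)) (vector_derivative X (at s))"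

text \<open>\<open>F\<close> is a value of the indefinite integral of \<open>f\<close> on \<open>I\<close>, which is determined only up to
  an additive constant when \<open>I\<close> is an interval.\<close>

definition is_indefinite_integral :: "real set \<Rightarrow> (real \<Rightarrow> real) \<Rightarrow> (real \<Rightarrow> real) \<Rightarrow> bool" where
  "is_indefinite_integral I f F \<longleftrightarrow> (\<forall>s\<in>I. (F has_real_derivative f s) (at s))"

definition is_energy :: "real set \<Rightarrow> (real \<Rightarrow> real ^ 4) \<Rightarrow> (real \<Rightarrow> real) \<Rightarrow> bool" where
  "is_energy I X E \<longleftrightarrow>
     (\<exists>F. is_indefinite_integral I (sasaki_value X) F \<and> (\<forall>s\<in>I. E s = 1 / 2 * F s))"

text \<open>Since the derivative of \<open>B\<^sub>2\<close> is \<open>- \<epsilon>\<^sub>2 \<sigma> B\<^sub>1\<close> and the square of \<open>B\<^sub>1\<close> is \<open>\<epsilon>\<^sub>2\<close>, the coefficient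
  of the integral of \<open>\<sigma>\<^sup>2\<close> in the energy of \<open>B\<^sub>2\<close> is \<open>\<epsilon>\<^sub>2 / 2\<close>. The published formula has
  \<open>\<epsilon>\<^sub>3 / 2\<close> there, which is incompatible with these definitions whenever \<open>\<epsilon>\<^sub>2 \<noteq> \<epsilon>\<^sub>3\<close>; the
  theorem is stated with \<open>\<epsilon>\<^sub>2 / 2\<close>.\<close>

end

theory Submission
  imports Defs
begin

text \<open>Every Frenet-Serret derivative is a combination of the isotropic vectors
  \<open>N\<close>, \<open>B\<^sub>1\<close>, \<open>B\<^sub>2\<close>. On isotropic vectors the
  scalar product is an honest bilinear form of signature (-,+,+), so Pythagoras applies: the square
  of a derivative is the sum of its squared coefficients, each weighted by the sign of its frame
  vector. The factors \<pm>1 in the coefficients square away, which gives the Sasaki values in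
  \<open>frenet_serret_sasaki_values\<close>. Each of them is a constant plus multiples of squared
  curvatures, so a primitive is read off by linearity
  (\<open>is_indefinite_integral_affine\<close>). Finally, primitives on an interval differ by
  constants, so by \<open>is_energy_iff\<close> one primitive determines all energies.\<close>

lemma pg_inner_isotropic:
  assumes "isotropic U" and "isotropic V"
  shows "pg_inner U V = - (U $ 2 * V $ 2) + U $ 3 * V $ 3 + U $ 4 * V $ 4"
  using assms by (simp add: pg_inner_def isotropic_def)

lemma isotropic_add: "isotropic U \<Longrightarrow> isotropic V \<Longrightarrow> isotropic (U + V)"
  by (simp add: isotropic_def)

lemma isotropic_scaleR: "isotropic U \<Longrightarrow> isotropic (a *\<^sub>R U)"
  by (simp add: isotropic_def)

lemma pg_inner_scaleR_self:
  assumes "isotropic U"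
  shows "pg_inner (a *\<^sub>R U) (a *\<^sub>R U) = a\<^sup>2 * pg_inner U U"
  using assms by (simp add: pg_inner_isotropic isotropic_scaleR power2_eq_square algebra_simps)

text \<open>Pythagoras; isotropy keeps all three products in the second case of
  \<open>pg_inner\<close>, where the form is bilinear.\<close>

lemma pg_inner_add_self:
  assumes "isotropic U" and "isotropic V" and "pg_inner U V = 0"
  shows "pg_inner (U + V) (U + V) = pg_inner U U + pg_inner V V"
  using assms by (simp add: pg_inner_isotropic isotropic_add algebra_simps)

lemma pg_inner_scaleR_scaleR:
  assumes "isotropic U" and "isotropic V"
  shows "pg_inner (a *\<^sub>R U) (b *\<^sub>R V) = a * b * pg_inner U V"
  using assms by (simp add: pg_inner_isotropic isotropic_scaleR algebra_simps)

lemma sasaki_value_eq: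
  assumes "(X has_vector_derivative X') (at s)"
  shows "sasaki_value X s = pg_inner (X s) (X s) + pg_inner X' X'"
  using assms by (simp add: sasaki_value_def vector_derivative_at)

text \<open>The difference has zero derivative, and an interval is convex, so a single constant
  serves all of \<open>I\<close>.\<close>

lemma indefinite_integral_diff_const:
  assumes "is_interval I"
    and "is_indefinite_integral I f F" and "is_indefinite_integral I f G"
  obtains c where "\<And>s. s \<in> I \<Longrightarrow> F s = G s + c"
proof -
  have "((\<lambda>s. F s - G s) has_field_derivative 0) (at s within I)" if "s \<in> I" for s
    using assms(2,3) that
    by (auto simp: is_indefinite_integral_def
        intro!: DERIV_subset[OF DERIV_diff[THEN DERIV_cong]])
  then obtain c where "\<And>s. s \<in> I \<Longrightarrow> F s - G s = c"
    using has_field_derivative_zero_constant[of I "\<lambda>s. F s - G s"]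
      is_interval_convex[OF \<open>is_interval I\<close>] by blast
  then have "\<And>s. s \<in> I \<Longrightarrow> F s = G s + c"
    by (simp add: algebra_simps)
  then show thesis
    by (rule that)
qed

text \<open>Trades the existential over primitives in \<open>is_energy\<close> for one known
  primitive \<open>G\<close>, so that each energy formula becomes a characterization up to a
  constant.\<close>

lemma is_energy_iff:
  assumes "is_interval I" and G: "is_indefinite_integral I (sasaki_value X) G"
  shows "is_energy I X E \<longleftrightarrow> (\<exists>c. \<forall>s\<in>I. E s = 1 / 2 * G s + c)"
proof
  assume "is_energy I X E"
  then obtain F where F: "is_indefinite_integral I (sasaki_value X) F"
    and E: "\<forall>s\<in>I. E s = 1 / 2 * F s"
    by (auto simp: is_energy_def)
  obtain c where "\<And>s. s \<in> I \<Longrightarrow> F s = G s + c"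
    using indefinite_integral_diff_const[OF \<open>is_interval I\<close> F G] by blast
  with E have "\<forall>s\<in>I. E s = 1 / 2 * G s + c / 2"
    by (simp add: field_simps)
  then show "\<exists>c. \<forall>s\<in>I. E s = 1 / 2 * G s + c" ..
next
  assume "\<exists>c. \<forall>s\<in>I. E s = 1 / 2 * G s + c"
  then obtain c where E: "\<forall>s\<in>I. E s = 1 / 2 * G s + c" ..
  \<comment> \<open>The energy is half of a primitive, so the constant \<open>c\<close> must be
    doubled inside it.\<close>
  have "is_indefinite_integral I (sasaki_value X) (\<lambda>s. G s + 2 * c)"
    using G by (auto simp: is_indefinite_integral_def intro!: DERIV_add[THEN DERIV_cong])
  moreover have "\<forall>s\<in>I. E s = 1 / 2 * (G s + 2 * c)"
    using E by simp
  ultimately show "is_energy I X E"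
    unfolding is_energy_def by blast
qed

lemma is_indefinite_integral_affine:
  assumes "is_indefinite_integral I f F" and "is_indefinite_integral I g G"
    and "\<And>s. s \<in> I \<Longrightarrow> h s = a + b * f s + c * g s"
  shows "is_indefinite_integral I h (\<lambda>s. a * s + b * F s + c * G s)"
  using assms by (auto simp: is_indefinite_integral_def intro!: derivative_eq_intros)

text \<open>The leading constant is the square of the field itself; every other term is a squared
  curvature times the sign of the frame vector along which the derivative points.\<close>

lemma frenet_serret_sasaki_values:
  assumes "frenet_serret_frame I \<Omega> \<epsilon>\<^sub>1 \<epsilon>\<^sub>2 \<epsilon>\<^sub>3 T N B\<^sub>1 B\<^sub>2 \<kappa> \<tau> \<sigma>" and "s \<in> I"
  shows "sasaki_value T s = 1 + \<epsilon>\<^sub>1 * (\<kappa> s)\<^sup>2"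
    and "sasaki_value N s = \<epsilon>\<^sub>1 + \<epsilon>\<^sub>2 * (\<tau> s)\<^sup>2"
    and "sasaki_value B\<^sub>1 s = \<epsilon>\<^sub>2 + \<epsilon>\<^sub>1 * (\<tau> s)\<^sup>2 + \<epsilon>\<^sub>3 * (\<sigma> s)\<^sup>2"
    and "sasaki_value B\<^sub>2 s = \<epsilon>\<^sub>3 + \<epsilon>\<^sub>2 * (\<sigma> s)\<^sup>2"
proof -
  have sq: "\<epsilon>\<^sub>1\<^sup>2 = 1" "\<epsilon>\<^sub>2\<^sup>2 = 1" "\<epsilon>\<^sub>3\<^sup>2 = 1"
    using assms(1) by (auto simp: frenet_serret_frame_def frenet_signs_def)
  have "pg_orthonormal_frame \<epsilon>\<^sub>1 \<epsilon>\<^sub>2 \<epsilon>\<^sub>3 (T s) (N s) (B\<^sub>1 s) (B\<^sub>2 s)"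
    and T: "(T has_vector_derivative (\<epsilon>\<^sub>1 * \<kappa> s) *\<^sub>R N s) (at s)"
    and N: "(N has_vector_derivative (\<epsilon>\<^sub>2 * \<tau> s) *\<^sub>R B\<^sub>1 s) (at s)"
    and B1: "(B\<^sub>1 has_vector_derivative
       (- \<epsilon>\<^sub>1 * \<tau> s) *\<^sub>R N s + (\<epsilon>\<^sub>3 * \<sigma> s) *\<^sub>R B\<^sub>2 s) (at s)"
    and B2: "(B\<^sub>2 has_vector_derivative (- \<epsilon>\<^sub>2 * \<sigma> s) *\<^sub>R B\<^sub>1 s) (at s)"
    using assms unfolding frenet_serret_frame_def by blast+
  then have iso: "isotropic (N s)" "isotropic (B\<^sub>1 s)" "isotropic (B\<^sub>2 s)"
    and inner: "pg_inner (N s) (B\<^sub>2 s) = 0" "pg_inner (T s) (T s) = 1"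
      "pg_inner (N s) (N s) = \<epsilon>\<^sub>1" "pg_inner (B\<^sub>1 s) (B\<^sub>1 s) = \<epsilon>\<^sub>2" "pg_inner (B\<^sub>2 s) (B\<^sub>2 s) = \<epsilon>\<^sub>3"
    by (simp_all add: pg_orthonormal_frame_def)
  show "sasaki_value T s = 1 + \<epsilon>\<^sub>1 * (\<kappa> s)\<^sup>2"
    by (simp add: sasaki_value_eq[OF T] pg_inner_scaleR_self iso inner power_mult_distrib sq)
  show "sasaki_value N s = \<epsilon>\<^sub>1 + \<epsilon>\<^sub>2 * (\<tau> s)\<^sup>2"
    by (simp add: sasaki_value_eq[OF N] pg_inner_scaleR_self iso inner power_mult_distrib sq)
  show "sasaki_value B\<^sub>1 s = \<epsilon>\<^sub>2 + \<epsilon>\<^sub>1 * (\<tau> s)\<^sup>2 + \<epsilon>\<^sub>3 * (\<sigma> s)\<^sup>2"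
    unfolding sasaki_value_eq[OF B1]
    \<comment> \<open>The two summands are orthogonal because \<open>N\<close> and
      \<open>B\<^sub>2\<close> are. Dropping \<open>scaleR_minus_left\<close> keeps the minus sign
      inside the scalar, where squaring removes it.\<close>
    by (subst pg_inner_add_self)
      (simp_all add: isotropic_scaleR pg_inner_scaleR_self pg_inner_scaleR_scaleR iso inner
        power_mult_distrib sq del: scaleR_minus_left)
  show "sasaki_value B\<^sub>2 s = \<epsilon>\<^sub>3 + \<epsilon>\<^sub>2 * (\<sigma> s)\<^sup>2"
    by (simp add: sasaki_value_eq[OF B2] pg_inner_scaleR_self iso inner power_mult_distrib sq
        del: scaleR_minus_left)
qed

theorem theorem7:
  fixes I :: "real set"
    and \<Omega> T N B\<^sub>1 B\<^sub>2 :: "real \<Rightarrow> real ^ 4"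
    and \<epsilon>\<^sub>1 \<epsilon>\<^sub>2 \<epsilon>\<^sub>3 :: real
    and \<kappa> \<tau> \<sigma> K2 T2 S2 E :: "real \<Rightarrow> real"
  assumes "open I" and "is_interval I"
    and "admissible_curve I \<Omega>"
    and "arclength_parametrized I \<Omega>"
    and "frenet_serret_frame I \<Omega> \<epsilon>\<^sub>1 \<epsilon>\<^sub>2 \<epsilon>\<^sub>3 T N B\<^sub>1 B\<^sub>2 \<kappa> \<tau> \<sigma>"
    and "\<And>s. s \<in> I \<Longrightarrow> \<kappa> s \<noteq> 0 \<and> \<tau> s \<noteq> 0 \<and> \<sigma> s \<noteq> 0"
    and "is_indefinite_integral I (\<lambda>s. (\<kappa> s)\<^sup>2) K2"
    and "is_indefinite_integral I (\<lambda>s. (\<tau> s)\<^sup>2) T2"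
    and "is_indefinite_integral I (\<lambda>s. (\<sigma> s)\<^sup>2) S2"
  shows "(is_energy I T E \<longleftrightarrow>
           (\<exists>c\<^sub>1. \<forall>s\<in>I. E s = s / 2 + \<epsilon>\<^sub>1 / 2 * K2 s + c\<^sub>1)) \<and>
         (is_energy I N E \<longleftrightarrow>
           (\<exists>c\<^sub>2. \<forall>s\<in>I. E s = \<epsilon>\<^sub>1 / 2 * s + \<epsilon>\<^sub>2 / 2 * T2 s + c\<^sub>2)) \<and>
         (is_energy I B\<^sub>1 E \<longleftrightarrow>
           (\<exists>c\<^sub>3. \<forall>s\<in>I. E s = \<epsilon>\<^sub>2 / 2 * s + \<epsilon>\<^sub>1 / 2 * T2 s + \<epsilon>\<^sub>3 / 2 * S2 s + c\<^sub>3)) \<and>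
         (is_energy I B\<^sub>2 E \<longleftrightarrow>
           (\<exists>c\<^sub>4. \<forall>s\<in>I. E s = \<epsilon>\<^sub>3 / 2 * s + \<epsilon>\<^sub>2 / 2 * S2 s + c\<^sub>4))"
proof -
  note sasaki = frenet_serret_sasaki_values[OF assms(5)]
  have zero: "is_indefinite_integral I (\<lambda>_. 0) (\<lambda>_. 0)"
    by (simp add: is_indefinite_integral_def)
  \<comment> \<open>Only \<open>B\<^sub>1\<close> involves two curvatures; for the other fields a
    zero integrand fills the second slot, hence the summand \<open>0 * 0\<close>.\<close>
  have "is_indefinite_integral I (sasaki_value T) (\<lambda>s. 1 * s + \<epsilon>\<^sub>1 * K2 s + 0 * 0)"
    by (rule is_indefinite_integral_affine[OF assms(7) zero]) (simp add: sasaki)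
  moreover have "is_indefinite_integral I (sasaki_value N) (\<lambda>s. \<epsilon>\<^sub>1 * s + \<epsilon>\<^sub>2 * T2 s + 0 * 0)"
    by (rule is_indefinite_integral_affine[OF assms(8) zero]) (simp add: sasaki)
  moreover have "is_indefinite_integral I (sasaki_value B\<^sub>1)
      (\<lambda>s. \<epsilon>\<^sub>2 * s + \<epsilon>\<^sub>1 * T2 s + \<epsilon>\<^sub>3 * S2 s)"
    by (rule is_indefinite_integral_affine[OF assms(8,9)]) (simp add: sasaki)
  moreover have "is_indefinite_integral I (sasaki_value B\<^sub>2) (\<lambda>s. \<epsilon>\<^sub>3 * s + \<epsilon>\<^sub>2 * S2 s + 0 * 0)"
    by (rule is_indefinite_integral_affine[OF assms(9) zero]) (simp add: sasaki)
  ultimately show ?thesis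
    by (simp add: is_energy_iff[OF assms(2)] algebra_simps add_divide_distrib)
qed

end
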